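(* There are absolute constants $C_1,C_2>0$ such that $$\left\lfloor\frac{n^2}{4}\right\rfloor-C_1n^{4/3}\leq f(n)\leq\left\lfloor\frac{n^2}{4}\right\rfloor-C_2n^{4/3}$$ for every sufficiently large integer $n$, where $f(n)=\max_{|V(G)|=n}\bigl(\operatorname{cp}(G)-\operatorname{cc}(G)\bigr)$, the maximum being over all graphs $G$ on $n$ vertices.
   Context: All graphs are finite, simple and undirected. A clique $Q$ in a graph $G$ is a set of pairwise adjacent vertices (cliques of order two, i.e. single edges, are allowed), and $E(Q)$ is the set of edges of $G$ with both ends in $Q$. A clique cover of $G$ is a family $\mathcal C$ of cliques of $G$ with $E(G)\subseteq\bigcup_{Q\in\mathcal C}E(Q)$. A clique partition of $G$ is a family $\mathcal C$ of cliques such that the sets $E(Q)$, $Q\in\mathcal C$, are pairwise disjoint with union $E(G)$. $\operatorname{cc}(G)$ and $\operatorname{cp}(G)$ denote the minimum cardinality of a clique cover and of a clique partition of $G$, respectively. *)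

theory Defs
  imports "HOL-Analysis.Analysis" "HOL-Library.Ramsey"
begin

text \<open>A finite simple undirected graph is a finite vertex set \<open>V\<close> with a set \<open>E\<close> of two-element
  subsets of \<open>V\<close>, as for \<^const>\<open>clique\<close> in the Ramsey theory.\<close>

definition simple_graph :: "'a set \<Rightarrow> 'a set set \<Rightarrow> bool" where
  "simple_graph V E \<longleftrightarrow> finite V \<and> E \<subseteq> [V]\<^bsup>2\<^esup>"

definition edges_within :: "'a set set \<Rightarrow> 'a set \<Rightarrow> 'a set set" where
  "edges_within E Q = {e \<in> E. e \<subseteq> Q}"

definition clique_family :: "'a set \<Rightarrow> 'a set set \<Rightarrow> 'a set set \<Rightarrow> bool" where
  "clique_family V E \<C> \<longleftrightarrow> (\<forall>Q\<in>\<C>. Q \<subseteq> V \<and> clique Q E)"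

definition clique_cover :: "'a set \<Rightarrow> 'a set set \<Rightarrow> 'a set set \<Rightarrow> bool" where
  "clique_cover V E \<C> \<longleftrightarrow> clique_family V E \<C> \<and> E \<subseteq> (\<Union>Q\<in>\<C>. edges_within E Q)"

definition clique_partition :: "'a set \<Rightarrow> 'a set set \<Rightarrow> 'a set set \<Rightarrow> bool" where
  "clique_partition V E \<C> \<longleftrightarrow>
     clique_family V E \<C> \<and> disjoint_family_on (edges_within E) \<C> \<and>
     (\<Union>Q\<in>\<C>. edges_within E Q) = E"

definition cc :: "'a set \<Rightarrow> 'a set set \<Rightarrow> nat" where
  "cc V E = Min {card \<C> |\<C>. clique_cover V E \<C>}"

definition cp :: "'a set \<Rightarrow> 'a set set \<Rightarrow> nat" where
  "cp V E = Min {card \<C> |\<C>. clique_partition V E \<C>}"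

text \<open>Every finite graph is isomorphic to one whose vertices are natural numbers, so the maximum
  may be taken over these.  The difference is an integer, to avoid truncated subtraction.\<close>

definition max_cp_cc_gap :: "nat \<Rightarrow> int" where
  "max_cp_cc_gap n =
     Max {int (cp V E) - int (cc V E) |(V :: nat set) E. simple_graph V E \<and> card V = n}"

text \<open>The sets under \<^const>\<open>Min\<close> and \<^const>\<open>Max\<close> are finite and nonempty, so these operators
  yield genuine minima and maxima.\<close>

lemma clique_partition_edges:
  assumes "simple_graph V E"
  shows "clique_partition V E E"
proof -
  have c: "finite e" "card e = 2" "e \<subseteq> V" if "e \<in> E" for e
    using assms that by (auto simp: simple_graph_def nsets_def)
  have w: "edges_within E e = {e}" if "e \<in> E" for e
  proof -
    have "x = e" if "x \<in> E" "x \<subseteq> e" for x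
      using card_subset_eq[OF c(1)[OF \<open>e \<in> E\<close>] that(2)] c(2) that(1) \<open>e \<in> E\<close> by simp
    then show ?thesis using that by (auto simp: edges_within_def)
  qed
  have "clique e E" if "e \<in> E" for e
    unfolding clique_def
  proof (intro ballI impI)
    fix v w assume "v \<in> e" "w \<in> e" "v \<noteq> w"
    then have "{v, w} = e"
      using c[OF that] by (intro card_subset_eq) auto
    then show "{v, w} \<in> E" using that by simp
  qed
  then show ?thesis
    using c(3) by (auto simp: clique_partition_def clique_family_def disjoint_family_on_def w)
qed

lemma clique_partition_imp_cover: "clique_partition V E \<C> \<Longrightarrow> clique_cover V E \<C>"
  by (auto simp: clique_partition_def clique_cover_def)

lemma finite_cover_cards:
  assumes "simple_graph V E"
  shows "finite {card \<C> |\<C>. clique_cover V E \<C>}"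
proof -
  have "{\<C>. clique_cover V E \<C>} \<subseteq> Pow (Pow V)"
    by (auto simp: clique_cover_def clique_family_def)
  then have "finite {\<C>. clique_cover V E \<C>}"
    using assms by (auto intro: finite_subset simp: simple_graph_def)
  then show ?thesis by simp
qed

lemma finite_partition_cards:
  assumes "simple_graph V E"
  shows "finite {card \<C> |\<C>. clique_partition V E \<C>}"
  by (rule finite_subset[OF _ finite_cover_cards[OF assms]])
     (auto intro: clique_partition_imp_cover)

lemma cover_cards_nonempty:
  "simple_graph V E \<Longrightarrow> {card \<C> |\<C>. clique_cover V E \<C>} \<noteq> {}"
  using clique_partition_edges clique_partition_imp_cover by blast

lemma partition_cards_nonempty:
  "simple_graph V E \<Longrightarrow> {card \<C> |\<C>. clique_partition V E \<C>} \<noteq> {}"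
  using clique_partition_edges by blast

lemma gap_values_finite:
  "finite {int (cp V E) - int (cc V E) |(V :: nat set) E. simple_graph V E \<and> card V = n}"
proof (rule finite_subset)
  show "{int (cp V E) - int (cc V E) |(V :: nat set) E. simple_graph V E \<and> card V = n}
          \<subseteq> {- int (n choose 2)..int (n choose 2)}"
  proof clarify
    fix V :: "nat set" and E assume g: "simple_graph V E" and n: "n = card V"
    have "finite V" "E \<subseteq> [V]\<^bsup>2\<^esup>" using g by (auto simp: simple_graph_def)
    then have E: "card E \<le> card V choose 2"
      using card_mono[OF finite_imp_finite_nsets] card_nsets by metis
    have p: "cp V E \<le> card E"
      unfolding cp_def using clique_partition_edges[OF g]
      by (intro Min_le finite_partition_cards g) blast
    have c: "cc V E \<le> card E"
      unfolding cc_def using clique_partition_edges[OF g] clique_partition_imp_cover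
      by (intro Min_le finite_cover_cards g) blast
    show "int (cp V E) - int (cc V E) \<in> {- int (card V choose 2)..int (card V choose 2)}"
      using E p c by simp
  qed
qed simp

lemma gap_values_nonempty:
  "{int (cp V E) - int (cc V E) |(V :: nat set) E. simple_graph V E \<and> card V = n} \<noteq> {}"
proof -
  have "simple_graph {..<n} {} \<and> card {..<n} = n" by (simp add: simple_graph_def)
  then show ?thesis by blast
qed

end

theory Submission
  imports Defs
begin

text \<open>
  Lower bound. Take a complete bipartite graph between two halves of the \<open>n\<close> vertices and fill
  each half with disjoint cliques, the blocks, of order \<open>k\<close> close to \<open>n\<^sup>1\<^sup>/\<^sup>3\<close>. The union of a
  block of one half with a block of the other is a clique, so about \<open>(n/k)\<^sup>2 = O(n\<^sup>4\<^sup>/\<^sup>3)\<close> cliques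
  cover the graph. In a clique partition, a clique with \<open>s\<close> vertices in one half and \<open>t\<close> in the
  other contains \<open>s t\<close> of the roughly \<open>n\<^sup>2/4\<close> bipartite edges, and it uses up \<open>(s choose 2) + (t
  choose 2)\<close> edges inside blocks. As \<open>s t - 1\<close> is at most twice the latter number, a partition
  has at least \<open>\<lfloor>n\<^sup>2/4\<rfloor>\<close> members minus twice the number of edges inside blocks, of which there
  are at most \<open>n k = O(n\<^sup>4\<^sup>/\<^sup>3)\<close>.

  Upper bound. Let \<open>e\<close> be the number of edges, and write \<open>cp\<close>, \<open>cc\<close> for the two minimum
  cardinalities. The proof plays two facts against each other.

  First, \<open>cp \<le> n\<^sup>2/4 - (e - n\<^sup>2/4)/30 + O(n)\<close> (lemma \<open>cp_edges_tradeoff\<close>): the bound \<open>n\<^sup>2/4\<close> of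
  Erdos, Goodman and Posa improves when there are more than \<open>n\<^sup>2/4\<close> edges. It is proved by
  removing a vertex of minimum degree together with cliques of order at most four through it.

  Second, a graph covered by few cliques is far from triangle-free (lemma
  \<open>triangle_hitting_lower_bound\<close>). Suppose that deleting a set \<open>R\<close> of edges destroys all
  triangles. If a remaining edge \<open>uv\<close> lies in a clique of order \<open>q\<close>, then every other vertex of
  the clique is joined to \<open>u\<close> or to \<open>v\<close> by an edge of \<open>R\<close>, so the degrees of \<open>u\<close> and \<open>v\<close> in \<open>R\<close>
  add up to at least \<open>q - 2\<close>. With about \<open>n\<^sup>2/4\<close> edges in only \<open>m\<close> cliques, most edges lie in
  cliques of order at least a constant times \<open>n/\<surd>m\<close>, and summing over the edges shows that \<open>R\<close>
  has at least a constant times \<open>n\<^sup>2/\<surd>m\<close> elements.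

  Now suppose \<open>cp - cc > n\<^sup>2/4 - c n\<^sup>4\<^sup>/\<^sup>3\<close>. By the first fact, \<open>cc\<close> is at most about \<open>c n\<^sup>4\<^sup>/\<^sup>3\<close>, and
  \<open>e\<close> exceeds \<open>cp\<close> by at most a multiple of \<open>c n\<^sup>4\<^sup>/\<^sup>3\<close>. Each triangle of an edge-disjoint family
  saves two members of a partition into edges, so a maximal such family has \<open>O(c n\<^sup>4\<^sup>/\<^sup>3)\<close>
  triangles. Its edges form a set \<open>R\<close> as above, and the second fact gives it at least a constant
  times \<open>n\<^sup>4\<^sup>/\<^sup>3/\<surd>c\<close> elements. For small \<open>c\<close> this is impossible; \<open>c = 1/1000\<close> suffices.
\<close>

section \<open>Cliques, edges and optimal families\<close>

lemma simple_graph_edge: "simple_graph V E \<Longrightarrow> e \<in> E \<Longrightarrow> e \<subseteq> V \<and> finite e \<and> card e = 2"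
  by (auto simp: simple_graph_def nsets_def)

lemma simple_graph_finite_edges: "simple_graph V E \<Longrightarrow> finite E"
  unfolding simple_graph_def using finite_imp_finite_nsets finite_subset by blast

lemma simple_graph_subset: "simple_graph V E \<Longrightarrow> E' \<subseteq> E \<Longrightarrow> simple_graph V E'"
  by (auto simp: simple_graph_def)

lemma edges_within_clique:
  assumes "simple_graph V E" "clique Q E"
  shows "edges_within E Q = [Q]\<^bsup>2\<^esup>"
proof
  show "edges_within E Q \<subseteq> [Q]\<^bsup>2\<^esup>"
    using simple_graph_edge[OF assms(1)] by (auto simp: edges_within_def nsets_def)
  show "[Q]\<^bsup>2\<^esup> \<subseteq> edges_within E Q"
  proof
    fix e assume e: "e \<in> [Q]\<^bsup>2\<^esup>"
    then obtain u v where "e = {u, v}" "u \<noteq> v" "e \<subseteq> Q"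
      by (auto simp: nsets_def card_2_iff)
    then show "e \<in> edges_within E Q"
      using assms(2) by (auto simp: clique_def edges_within_def)
  qed
qed

lemma finite_clique_family: "finite V \<Longrightarrow> clique_family V E \<C> \<Longrightarrow> finite \<C>"
  by (rule finite_subset[of _ "Pow V"]) (auto simp: clique_family_def)

lemma cp_le:
  assumes "simple_graph V E" "clique_partition V E \<C>"
  shows "cp V E \<le> card \<C>"
  unfolding cp_def using assms by (intro Min_le finite_partition_cards) auto

lemma cp_attained:
  assumes "simple_graph V E"
  obtains \<C> where "clique_partition V E \<C>" "card \<C> = cp V E"
proof -
  have "cp V E \<in> {card \<C> |\<C>. clique_partition V E \<C>}"
    unfolding cp_def
    by (rule Min_in[OF finite_partition_cards[OF assms] partition_cards_nonempty[OF assms]])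
  then show ?thesis using that by auto
qed

lemma cc_le:
  assumes "simple_graph V E" "clique_cover V E \<C>"
  shows "cc V E \<le> card \<C>"
  unfolding cc_def using assms by (intro Min_le finite_cover_cards) auto

lemma cc_attained:
  assumes "simple_graph V E"
  obtains \<C> where "clique_cover V E \<C>" "card \<C> = cc V E"
proof -
  have "cc V E \<in> {card \<C> |\<C>. clique_cover V E \<C>}"
    unfolding cc_def
    by (rule Min_in[OF finite_cover_cards[OF assms] cover_cards_nonempty[OF assms]])
  then show ?thesis using that by auto
qed

lemma cp_le_card_edges: "simple_graph V E \<Longrightarrow> cp V E \<le> card E"
  by (rule cp_le[OF _ clique_partition_edges])

text \<open>Some edge-disjoint cliques are fixed, and what is left is partitioned optimally. A clique
  of the remaining graph contains no edge of the
  committed ones, so the two families fit together.\<close>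
lemma cp_le_add_remainder:
  assumes G: "simple_graph V E" and D: "clique_family V E \<D>"
    and dis: "disjoint_family_on (edges_within E) \<D>"
    and V': "V' \<subseteq> V" and E': "E' = E - (\<Union>Q\<in>\<D>. edges_within E Q)"
    and G': "simple_graph V' E'"
  shows "cp V E \<le> card \<D> + cp V' E'"
proof -
  obtain \<C> where C: "clique_partition V' E' \<C>" and card: "card \<C> = cp V' E'"
    using cp_attained[OF G'] .
  have cl': "clique Q E'" and QV: "Q \<subseteq> V'" if "Q \<in> \<C>" for Q
    using C that by (auto simp: clique_partition_def clique_family_def)
  have cl: "clique Q E" if "Q \<in> \<C>" for Q
    using cl'[OF that] by (auto simp: clique_def E')
  have same: "edges_within E Q = edges_within E' Q" if "Q \<in> \<C>" for Q
    using edges_within_clique[OF G cl[OF that]] edges_within_clique[OF G' cl'[OF that]] by simp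
  have un: "(\<Union>Q\<in>\<C>. edges_within E Q) = E'"
    using C same by (auto simp: clique_partition_def)
  have sep: "edges_within E P \<inter> edges_within E Q = {}" if "P \<in> \<D>" "Q \<in> \<C>" for P Q
    using that un E' by blast
  have "disjoint_family_on (edges_within E) \<C>"
    using C same by (simp add: clique_partition_def disjoint_family_on_def)
  then have "disjoint_family_on (edges_within E) (\<D> \<union> \<C>)"
    using dis sep unfolding disjoint_family_on_def by blast
  moreover have "clique_family V E (\<D> \<union> \<C>)"
    using D cl subset_trans[OF QV V'] by (auto simp: clique_family_def)
  moreover have "(\<Union>Q\<in>\<D> \<union> \<C>. edges_within E Q) = E"
    using un E' by (auto simp: edges_within_def)
  ultimately have "clique_partition V E (\<D> \<union> \<C>)"
    by (simp add: clique_partition_def)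
  then have "cp V E \<le> card (\<D> \<union> \<C>)" by (rule cp_le[OF G])
  also have "\<dots> \<le> card \<D> + card \<C>" by (rule card_Un_le)
  finally show ?thesis using card by simp
qed

lemma card_edges_of_disjoint_cliques:
  assumes G: "simple_graph V E" and D: "clique_family V E \<D>"
    and dis: "disjoint_family_on (edges_within E) \<D>"
  shows "card (\<Union>Q\<in>\<D>. edges_within E Q) = (\<Sum>Q\<in>\<D>. card Q choose 2)"
proof -
  have fin: "finite \<D>" "finite E"
    using finite_clique_family[OF _ D] G simple_graph_finite_edges
    by (auto simp: simple_graph_def)
  have "card (\<Union>Q\<in>\<D>. edges_within E Q) = (\<Sum>Q\<in>\<D>. card (edges_within E Q))"
    using dis fin by (intro card_UN_disjoint) (auto simp: disjoint_family_on_def edges_within_def)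
  also have "\<dots> = (\<Sum>Q\<in>\<D>. card Q choose 2)"
    using edges_within_clique[OF G] D
    by (intro sum.cong) (auto simp: clique_family_def card_nsets)
  finally show ?thesis .
qed

lemma two_times_choose_two: "2 * (a choose 2) = a * (a - 1)"
  by (cases a) (simp_all add: choose_two dvd_mult_div_cancel)

section \<open>Peeling off a vertex\<close>

definition nbhd :: "'a set set \<Rightarrow> 'a \<Rightarrow> 'a set" where
  "nbhd E x = {y. {x, y} \<in> E}"

lemma nbhd_subset: "simple_graph V E \<Longrightarrow> nbhd E x \<subseteq> V - {x}"
  using simple_graph_edge[of V E "{x, y}" for y] by (force simp: nbhd_def)

lemma finite_nbhd: "simple_graph V E \<Longrightarrow> finite (nbhd E x)"
  by (rule finite_subset[OF nbhd_subset]) (auto simp: simple_graph_def)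

text \<open>The step of the induction over the vertices: adding \<open>x\<close> to each part of a clique partition
  of its neighbourhood gives edge-disjoint cliques that contain all edges at \<open>x\<close>.\<close>
lemma peel_vertex:
  assumes G: "simple_graph V E" and x: "x \<in> V"
    and P: "partition_on (nbhd E x) P" and cl: "\<And>p. p \<in> P \<Longrightarrow> clique p E"
  obtains E' where "simple_graph (V - {x}) E'" "cp V E \<le> card P + cp (V - {x}) E'"
    "card E = card E' + (\<Sum>p\<in>P. Suc (card p) choose 2)"
proof -
  have sub: "p \<subseteq> nbhd E x" if "p \<in> P" for p
    using P that by (auto simp: partition_on_def)
  have xp: "x \<notin> p" if "p \<in> P" for p
    using sub[OF that] nbhd_subset[OF G, of x] by auto
  have finp: "finite p" if "p \<in> P" for p
    using finite_subset[OF sub[OF that] finite_nbhd[OF G]] .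
  define \<D> where "\<D> = insert x ` P"
  define E' where "E' = E - (\<Union>Q\<in>\<D>. edges_within E Q)"
  have inj: "inj_on (insert x) P"
    using xp by (intro inj_onI) (metis insert_ident)
  have clx: "clique (insert x p) E" if "p \<in> P" for p
    using cl[OF that] sub[OF that] by (auto simp: clique_def nbhd_def insert_commute)
  have fam: "clique_family V E \<D>"
    using clx subset_trans[OF sub nbhd_subset[OF G]] x by (auto simp: clique_family_def \<D>_def)
  have dis: "disjoint_family_on (edges_within E) \<D>"
  proof -
    have "edges_within E (insert x p) \<inter> edges_within E (insert x q) = {}"
      if "p \<in> P" "q \<in> P" "p \<noteq> q" for p q
    proof -
      have "p \<inter> q = {}" using P that by (auto simp: partition_on_def disjoint_def)
      then have sub: "e \<subseteq> {x}" if "e \<subseteq> insert x p" "e \<subseteq> insert x q" for e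
        using that by blast
      have "\<not> (e \<subseteq> insert x p \<and> e \<subseteq> insert x q)" if "e \<in> E" for e
        using simple_graph_edge[OF G that] card_mono[OF _ sub[of e]] by auto
      then show ?thesis by (auto simp: edges_within_def)
    qed
    then show ?thesis by (auto simp: disjoint_family_on_def \<D>_def)
  qed
  have G': "simple_graph (V - {x}) E'"
  proof -
    have "x \<notin> e" if "e \<in> E'" for e
    proof
      assume "x \<in> e"
      moreover have e: "e \<in> E" using that by (simp add: E'_def)
      ultimately obtain y where y: "e = {x, y}"
        using simple_graph_edge[OF G e] by (auto simp: card_2_iff insert_commute)
      then have "y \<in> nbhd E x" using e by (simp add: nbhd_def)
      then obtain p where "p \<in> P" "y \<in> p" using P by (auto simp: partition_on_def)
      then have "e \<in> edges_within E (insert x p)" using e y by (simp add: edges_within_def)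
      then show False using that \<open>p \<in> P\<close> by (auto simp: E'_def \<D>_def)
    qed
    then have "E' \<subseteq> [V - {x}]\<^bsup>2\<^esup>"
      using simple_graph_edge[OF G] by (auto simp: nsets_def E'_def)
    then show ?thesis using G by (simp add: simple_graph_def)
  qed
  have "card \<D> = card P" using inj by (simp add: \<D>_def card_image)
  then have "cp V E \<le> card P + cp (V - {x}) E'"
    using cp_le_add_remainder[OF G fam dis _ E'_def G'] by auto
  moreover have "card E = card E' + (\<Sum>p\<in>P. Suc (card p) choose 2)"
  proof -
    have "(\<Union>Q\<in>\<D>. edges_within E Q) \<subseteq> E" by (auto simp: edges_within_def)
    then have "card E = card E' + card (\<Union>Q\<in>\<D>. edges_within E Q)"
      using simple_graph_finite_edges[OF G] unfolding E'_def
      by (metis card_Diff_subset card_mono finite_subset le_add_diff_inverse2)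
    also have "card (\<Union>Q\<in>\<D>. edges_within E Q) = (\<Sum>Q\<in>\<D>. card Q choose 2)"
      by (rule card_edges_of_disjoint_cliques[OF G fam dis])
    also have "\<dots> = (\<Sum>p\<in>P. Suc (card p) choose 2)"
      using xp finp by (simp add: \<D>_def sum.reindex[OF inj])
    finally show ?thesis .
  qed
  ultimately show ?thesis using that G' by blast
qed

section \<open>Packing disjoint cliques into a neighbourhood\<close>

definition clique_packing :: "'a set set \<Rightarrow> 'a set \<Rightarrow> nat \<Rightarrow> 'a set set \<Rightarrow> bool" where
  "clique_packing E N k M \<longleftrightarrow> disjoint M \<and> (\<forall>p\<in>M. p \<subseteq> N \<and> card p = k \<and> clique p E)"

lemma clique_packing_empty: "clique_packing E N k {}"
  by (simp add: clique_packing_def)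

lemma clique_packing_finite: "finite N \<Longrightarrow> clique_packing E N k M \<Longrightarrow> finite M"
  by (rule finite_subset[of _ "Pow N"]) (auto simp: clique_packing_def)

lemma maximum_clique_packing:
  assumes "finite N"
  obtains M where "clique_packing E N k M"
    "\<And>M'. clique_packing E N k M' \<Longrightarrow> card M' \<le> card M"
proof -
  have "\<forall>M. clique_packing E N k M \<longrightarrow> card M < Suc (card (Pow N))"
    using assms by (auto simp: clique_packing_def less_Suc_eq_le intro!: card_mono)
  from ex_has_greatest_nat[OF clique_packing_empty this]
  show ?thesis using that by auto
qed

lemma card_Union_clique_packing:
  assumes "finite N" "clique_packing E N k M"
  shows "card (\<Union>M) = k * card M"
proof -
  have "finite p" if "p \<in> M" for p
    using assms that finite_subset by (auto simp: clique_packing_def)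
  then have "card (\<Union>M) = (\<Sum>p\<in>M. card p)"
    using assms by (intro card_Union_disjoint)
      (auto simp: clique_packing_def disjoint_def pairwise_def disjnt_def)
  then show ?thesis using assms by (simp add: clique_packing_def)
qed

text \<open>The packed cliques and the remaining single vertices together partition \<open>N\<close>. The function
  \<open>f\<close> stands for the cost of a part of given size.\<close>
lemma partition_from_packing:
  fixes f :: "nat \<Rightarrow> nat"
  assumes N: "finite N" and M: "clique_packing E N k M" and k: "k \<ge> 2"
  obtains P where "partition_on N P" "\<And>p. p \<in> P \<Longrightarrow> clique p E"
    "(\<Sum>p\<in>P. f (card p)) = card M * f k + (card N - k * card M) * f 1"
    "k * card M \<le> card N"
proof -
  define S where "S = N - \<Union>M"
  define P where "P = M \<union> (\<lambda>v. {v}) ` S"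
  have UM: "\<Union>M \<subseteq> N" using M by (auto simp: clique_packing_def)
  have fin: "finite M" "finite S"
    using clique_packing_finite[OF N M] N by (auto simp: S_def)
  have cS: "card S = card N - k * card M"
    using card_Union_clique_packing[OF N M] UM N
    by (simp add: S_def card_Diff_subset finite_subset)
  have le: "k * card M \<le> card N"
    using card_mono[OF N UM] card_Union_clique_packing[OF N M] by simp
  have "partition_on N P"
  proof (rule partition_onI)
    show "\<Union>P = N" using UM by (auto simp: P_def S_def)
    show "{} \<notin> P"
      using M k by (auto simp: P_def clique_packing_def)
    show "disjnt p q" if "p \<in> P" "q \<in> P" "p \<noteq> q" for p q
      using that M by (auto simp: P_def S_def clique_packing_def disjoint_def disjnt_def)
  qed
  moreover have "clique p E" if "p \<in> P" for p
    using that M by (auto simp: P_def clique_packing_def clique_def)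
  moreover have "(\<Sum>p\<in>P. f (card p)) = card M * f k + (card N - k * card M) * f 1"
  proof -
    have "M \<inter> (\<lambda>v. {v}) ` S = {}" using M k by (auto simp: clique_packing_def)
    then have "(\<Sum>p\<in>P. f (card p)) = (\<Sum>p\<in>M. f (card p)) + (\<Sum>p\<in>(\<lambda>v. {v}) ` S. f (card p))"
      using fin by (simp add: P_def sum.union_disjoint)
    moreover have "(\<Sum>p\<in>M. f (card p)) = card M * f k"
      using M by (simp add: clique_packing_def)
    moreover have "(\<Sum>p\<in>(\<lambda>v. {v}) ` S. f (card p)) = card S * f 1"
      by (subst sum.reindex) auto
    ultimately show ?thesis using cS by simp
  qed
  ultimately show ?thesis using that le by blast
qed

lemma clique_pair: "clique {u, v} E \<longleftrightarrow> u = v \<or> {u, v} \<in> E"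
  by (auto simp: clique_def insert_commute)

lemma clique_packing_insert:
  assumes "clique_packing E N k M" "p \<subseteq> N" "card p = k" "clique p E" "p \<inter> \<Union>M = {}"
  shows "clique_packing E N k (insert p M)"
  using assms by (auto simp: clique_packing_def disjoint_def)

lemma clique_packing_subset:
  "clique_packing E N k M \<Longrightarrow> M' \<subseteq> M \<Longrightarrow> clique_packing E N k M'"
  by (simp add: clique_packing_def pairwise_subset[of disjnt M M'] subset_iff)
    (auto simp: pairwise_def)

text \<open>No augmenting path of length three exists for a maximum matching. Hence if \<open>u\<close> and \<open>v\<close> are
  two unmatched vertices, each edge of the matching receives at most two edges from \<open>u\<close> and \<open>v\<close>.
  All neighbours of \<open>u\<close> and \<open>v\<close> are matched, so the matching has at least as many edges as the
  minimum degree.\<close>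
lemma large_matching:
  assumes G: "simple_graph V E" and N: "finite N"
    and deg: "\<And>u. u \<in> N \<Longrightarrow> \<delta> \<le> card (nbhd E u \<inter> N)"
  obtains M where "clique_packing E N 2 M" "\<delta> \<le> card M \<or> card N \<le> 2 * card M + 1"
proof -
  obtain M where M: "clique_packing E N 2 M"
    and mx: "\<And>M'. clique_packing E N 2 M' \<Longrightarrow> card M' \<le> card M"
    using maximum_clique_packing[OF N] by metis
  have finM: "finite M" by (rule clique_packing_finite[OF N M])
  have "\<delta> \<le> card M" if big: "\<not> card N \<le> 2 * card M + 1"
  proof -
    have UM: "\<Union>M \<subseteq> N" using M by (auto simp: clique_packing_def)
    have "card (N - \<Union>M) = card N - 2 * card M"
      using card_Union_clique_packing[OF N M] card_Diff_subset[OF finite_subset[OF UM N] UM]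
      by simp
    then have "\<not> card (N - \<Union>M) \<le> Suc 0" using big by simp
    then obtain u v where uv: "u \<in> N - \<Union>M" "v \<in> N - \<Union>M" "u \<noteq> v"
      using N by (subst (asm) card_le_Suc0_iff_eq) auto
    have in_M: "nbhd E w \<inter> N \<subseteq> \<Union>M" if w: "w \<in> N - \<Union>M" for w
    proof (rule subsetI, rule ccontr)
      fix a assume a: "a \<in> nbhd E w \<inter> N" "a \<notin> \<Union>M"
      then have "a \<noteq> w" using nbhd_subset[OF G] by auto
      then have "clique_packing E N 2 (insert {w, a} M)"
        using a w by (intro clique_packing_insert[OF M]) (auto simp: clique_pair nbhd_def)
      moreover have "{w, a} \<notin> M" using w by auto
      ultimately show False using mx[of "insert {w, a} M"] finM by simp
    qed
    have no_aug: "\<not> (a \<in> e \<and> b \<in> e \<and> a \<noteq> b \<and> a \<in> nbhd E u \<and> b \<in> nbhd E v)" if e: "e \<in> M" for e a b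
    proof
      assume ab: "a \<in> e \<and> b \<in> e \<and> a \<noteq> b \<and> a \<in> nbhd E u \<and> b \<in> nbhd E v"
      let ?M0 = "M - {e}"
      have M0: "clique_packing E N 2 ?M0" by (rule clique_packing_subset[OF M]) auto
      have eN: "e \<subseteq> N" using M e by (auto simp: clique_packing_def)
      have away: "z \<notin> \<Union>?M0" if "z \<in> e" for z
        using M e that by (auto simp: clique_packing_def disjoint_def)
      have ne: "u \<noteq> a" "v \<noteq> b" "u \<noteq> b" "v \<noteq> a" using ab uv e by auto
      have M1: "clique_packing E N 2 (insert {u, a} ?M0)"
        using ab uv ne eN away[of a]
        by (intro clique_packing_insert[OF M0]) (auto simp: clique_pair nbhd_def)
      have M2: "clique_packing E N 2 (insert {v, b} (insert {u, a} ?M0))"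
        using ab uv ne eN away[of b]
        by (intro clique_packing_insert[OF M1]) (auto simp: clique_pair nbhd_def)
      have "{u, a} \<notin> ?M0" "{v, b} \<notin> insert {u, a} ?M0"
        using uv ne ab by (auto simp: doubleton_eq_iff)
      then have "card (insert {v, b} (insert {u, a} ?M0)) = Suc (Suc (card ?M0))"
        using finM by simp
      moreover have "card M = Suc (card ?M0)"
        using finM e by (metis card_Suc_Diff1)
      ultimately show False using mx[OF M2] by simp
    qed
    have two: "card (nbhd E u \<inter> e) + card (nbhd E v \<inter> e) \<le> 2" if e: "e \<in> M" for e
    proof -
      obtain a b where ab: "e = {a, b}" "a \<noteq> b"
        using M e by (auto simp: clique_packing_def card_2_iff)
      show ?thesis
        using no_aug[OF e, of a b] no_aug[OF e, of b a] ab
        by (cases "a \<in> nbhd E u"; cases "b \<in> nbhd E u"; cases "a \<in> nbhd E v"; cases "b \<in> nbhd E v")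
           (auto simp: Int_insert_right)
    qed
    have dec: "\<delta> \<le> (\<Sum>e\<in>M. card (nbhd E w \<inter> e))" if w: "w \<in> N - \<Union>M" for w
    proof -
      have "nbhd E w \<inter> N \<subseteq> (\<Union>e\<in>M. nbhd E w \<inter> e)" using in_M[OF w] by auto
      then have "card (nbhd E w \<inter> N) \<le> card (\<Union>e\<in>M. nbhd E w \<inter> e)"
        using finM finite_nbhd[OF G] by (intro card_mono) auto
      also have "\<dots> \<le> (\<Sum>e\<in>M. card (nbhd E w \<inter> e))"
        by (rule card_UN_le[OF finM])
      finally show ?thesis using deg[of w] w by simp
    qed
    have "2 * \<delta> \<le> (\<Sum>e\<in>M. card (nbhd E u \<inter> e) + card (nbhd E v \<inter> e))"
      using dec[OF uv(1)] dec[OF uv(2)] by (simp add: sum.distrib)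
    also have "\<dots> \<le> (\<Sum>e\<in>M. 2)" using two by (intro sum_mono)
    finally show ?thesis by simp
  qed
  then show ?thesis using that M by blast
qed

text \<open>The vertices \<open>S\<close> outside a maximum packing of triangles span no triangle. A vertex has at
  most \<open>card V - d\<close> non-neighbours, and the ends of an edge inside \<open>S\<close> have no common neighbour
  in \<open>S\<close>; this bounds the size of \<open>S\<close>.\<close>
lemma triangle_packing_leftover:
  assumes G: "simple_graph V E" and N: "N \<subseteq> V"
    and deg: "\<And>u. u \<in> N \<Longrightarrow> d \<le> card (nbhd E u)"
  obtains M where "clique_packing E N 3 M" "card N \<le> 3 * card M + 2 * (card V - d)"
proof -
  have finV: "finite V" using G by (simp add: simple_graph_def)
  have finN: "finite N" by (rule finite_subset[OF N finV])
  obtain M where M: "clique_packing E N 3 M"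
    and mx: "\<And>M'. clique_packing E N 3 M' \<Longrightarrow> card M' \<le> card M"
    using maximum_clique_packing[OF finN] by metis
  define S where "S = N - \<Union>M"
  have UM: "\<Union>M \<subseteq> N" using M by (auto simp: clique_packing_def)
  have miss: "card (S - nbhd E u) \<le> card V - d" if "u \<in> N" for u
  proof -
    have "card (S - nbhd E u) \<le> card (V - nbhd E u)"
      using finV N by (intro card_mono) (auto simp: S_def)
    also have "\<dots> = card V - card (nbhd E u)"
      using nbhd_subset[OF G, of u] finite_nbhd[OF G] by (intro card_Diff_subset) auto
    finally show ?thesis using deg[OF that] by simp
  qed
  have "card S \<le> 2 * (card V - d)"
  proof (cases "\<exists>u\<in>S. \<exists>v\<in>S. v \<in> nbhd E u")
    case True
    then obtain u v where uv: "u \<in> S" "v \<in> S" "v \<in> nbhd E u" by blast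
    have "w \<notin> nbhd E u \<or> w \<notin> nbhd E v" if w: "w \<in> S" for w
    proof (rule ccontr)
      assume "\<not> (w \<notin> nbhd E u \<or> w \<notin> nbhd E v)"
      then have wn: "w \<in> nbhd E u" "w \<in> nbhd E v" by auto
      have ne: "u \<noteq> v" "u \<noteq> w" "v \<noteq> w"
        using wn uv(3) nbhd_subset[OF G] by auto
      have cl: "clique {u, v, w} E"
        using wn uv(3) by (auto simp: clique_def nbhd_def insert_commute)
      have "clique_packing E N 3 (insert {u, v, w} M)"
        using uv w ne by (intro clique_packing_insert[OF M _ _ cl]) (auto simp: S_def)
      moreover have "{u, v, w} \<notin> M" using uv by (auto simp: S_def)
      ultimately show False
        using mx[of "insert {u, v, w} M"] clique_packing_finite[OF finN M] by simp
    qed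
    then have "S \<subseteq> (S - nbhd E u) \<union> (S - nbhd E v)" by auto
    then have "card S \<le> card ((S - nbhd E u) \<union> (S - nbhd E v))"
      using finN by (intro card_mono) (auto simp: S_def)
    also have "\<dots> \<le> card (S - nbhd E u) + card (S - nbhd E v)"
      by (rule card_Un_le)
    finally have "card S \<le> card (S - nbhd E u) + card (S - nbhd E v)" .
    then show ?thesis using miss[of u] miss[of v] uv by (simp add: S_def)
  next
    case False
    show ?thesis
    proof (cases "S = {}")
      case ne: False
      then obtain u where "u \<in> S" by blast
      then have "S - nbhd E u = S" using False by blast
      then show ?thesis using miss[of u] \<open>u \<in> S\<close> by (simp add: S_def)
    qed simp
  qed
  moreover have "card N \<le> card S + 3 * card M"
    using card_Union_clique_packing[OF finN M] UM finN finite_subset[OF UM finN]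
    by (simp add: S_def card_Diff_subset)
  ultimately show ?thesis using that M by simp
qed

section \<open>The trade-off between clique partitions and edges\<close>

text \<open>A part \<open>p\<close> of the neighbourhood of \<open>x\<close> costs one clique and removes \<open>Suc (card p) choose
  2\<close> edges. The cost function gives these the weights \<open>120\<close> and \<open>4\<close>, and with \<open>n = card V\<close> the
  bound \<open>62 n + 58\<close> is what the increment of \<open>31 n\<^sup>2 + 100 n\<close> permits. Single vertices suffice
  when the degree \<open>d\<close> of \<open>x\<close> is at most \<open>n/2\<close>. For larger \<open>d\<close> the minimum degree inside the
  neighbourhood is at least \<open>2 d - n\<close>, so there is a matching of that size or a nearly perfect
  one, and either offsets the excess of \<open>d\<close> over \<open>n/2\<close> as long as \<open>d \<le> 9 n/10\<close>. Beyond that,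
  even a perfect matching with its \<open>d/2\<close> parts is too expensive, but most of the neighbourhood
  can be packed with triangles.\<close>
lemma neighbourhood_partition:
  assumes G: "simple_graph V E" and x: "x \<in> V"
    and min: "\<And>u. u \<in> V \<Longrightarrow> card (nbhd E x) \<le> card (nbhd E u)"
  obtains P where "partition_on (nbhd E x) P" "\<And>p. p \<in> P \<Longrightarrow> clique p E"
    "4 * (\<Sum>p\<in>P. 30 + (Suc (card p) choose 2)) \<le> 62 * card V + 58"
proof -
  define n d N where "n = card V" and "d = card (nbhd E x)" and "N = nbhd E x"
  define f :: "nat \<Rightarrow> nat" where "f c = 30 + (Suc c choose 2)" for c
  have f: "f 1 = 31" "f 2 = 33" "f 3 = 36" by (simp_all add: f_def choose_two)
  have finV: "finite V" using G by (simp add: simple_graph_def)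
  have finN: "finite N" unfolding N_def by (rule finite_nbhd[OF G])
  have NV: "N \<subseteq> V" using nbhd_subset[OF G] by (auto simp: N_def)
  have dn: "d \<le> n" using card_mono[OF finV NV] by (simp add: d_def n_def N_def)
  have cN: "card N = d" by (simp add: N_def d_def)
  have "\<exists>P. partition_on N P \<and> (\<forall>p\<in>P. clique p E) \<and> 4 * (\<Sum>p\<in>P. f (card p)) \<le> 62 * n + 58"
  proof -
    consider "2 * d \<le> n" | "n < 2 * d" "10 * d \<le> 9 * n" | "9 * n < 10 * d" by linarith
    then show ?thesis
    proof cases
      case 1
      obtain P where P: "partition_on N P" "\<And>p. p \<in> P \<Longrightarrow> clique p E"
        "(\<Sum>p\<in>P. f (card p)) = d * 31"
        using partition_from_packing[OF finN clique_packing_empty[of E N 2], where f=f] f cN by auto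
      then show ?thesis using 1 by (intro exI[of _ P]) auto
    next
      case 2
      have deg: "2 * d - n \<le> card (nbhd E u \<inter> N)" if u: "u \<in> N" for u
      proof -
        have "nbhd E u \<union> N \<subseteq> V" using NV nbhd_subset[OF G] by auto
        then have "card (nbhd E u \<union> N) \<le> n"
          unfolding n_def by (rule card_mono[OF finV])
        moreover have "card (nbhd E u) + card N = card (nbhd E u \<union> N) + card (nbhd E u \<inter> N)"
          by (rule card_Un_Int[OF finite_nbhd[OF G] finN])
        moreover have "d \<le> card (nbhd E u)" using min[of u] u NV by (auto simp: d_def)
        ultimately show ?thesis using cN by linarith
      qed
      obtain M where M: "clique_packing E N 2 M" "2 * d - n \<le> card M \<or> card N \<le> 2 * card M + 1"
        using large_matching[OF G finN deg] by metis
      obtain P where P: "partition_on N P" "\<And>p. p \<in> P \<Longrightarrow> clique p E"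
        "(\<Sum>p\<in>P. f (card p)) = card M * 33 + (d - 2 * card M) * 31" "2 * card M \<le> d"
        using partition_from_packing[OF finN M(1), where f=f] f cN by auto
      have "4 * (card M * 33 + (d - 2 * card M) * 31) \<le> 62 * n + 58"
        using 2 M(2) P(4) cN by (auto simp: diff_mult_distrib)
      then show ?thesis using P by (intro exI[of _ P]) auto
    next
      case 3
      have "d \<le> card (nbhd E u)" if "u \<in> N" for u
        using min[of u] that NV by (auto simp: d_def)
      then obtain M where M: "clique_packing E N 3 M" "card N \<le> 3 * card M + 2 * (card V - d)"
        using triangle_packing_leftover[OF G NV] by metis
      obtain P where P: "partition_on N P" "\<And>p. p \<in> P \<Longrightarrow> clique p E"
        "(\<Sum>p\<in>P. f (card p)) = card M * 36 + (d - 3 * card M) * 31" "3 * card M \<le> d"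
        using partition_from_packing[OF finN M(1), where f=f] f cN by auto
      have "4 * (card M * 36 + (d - 3 * card M) * 31) \<le> 62 * n + 58"
        using 3 M(2) P(4) cN dn by (auto simp: diff_mult_distrib n_def)
      then show ?thesis using P by (intro exI[of _ P]) auto
    qed
  qed
  then show ?thesis using that unfolding N_def f_def n_def by blast
qed

text \<open>Divided by \<open>120\<close>, this is \<open>cp \<le> n\<^sup>2/4 - (e - n\<^sup>2/4)/30 + O(n)\<close>. Carrying the number of edges
  \<open>e\<close> along in the induction is what yields a gain for graphs with more than \<open>n\<^sup>2/4\<close> edges.\<close>
lemma cp_edges_tradeoff:
  assumes "simple_graph V E"
  shows "120 * cp V E + 4 * card E \<le> 31 * (card V)\<^sup>2 + 100 * card V"
  using assms
proof (induction "card V" arbitrary: V E)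
  case 0
  then have "V = {}" by (simp add: simple_graph_def)
  then have "E = {}" using simple_graph_edge[OF \<open>simple_graph V E\<close>] by fastforce
  then show ?case using cp_le_card_edges[OF \<open>simple_graph V E\<close>] by simp
next
  case (Suc k)
  note G = \<open>simple_graph V E\<close>
  have finV: "finite V" and ne: "V \<noteq> {}"
    using G Suc.hyps(2) by (auto simp: simple_graph_def)
  obtain x where x: "x \<in> V" and min: "\<And>u. u \<in> V \<Longrightarrow> card (nbhd E x) \<le> card (nbhd E u)"
    using ex_min_if_finite[of "(\<lambda>u. card (nbhd E u)) ` V"] finV ne by (auto simp: not_less)
  obtain P where P: "partition_on (nbhd E x) P" "\<And>p. p \<in> P \<Longrightarrow> clique p E"
    "4 * (\<Sum>p\<in>P. 30 + (Suc (card p) choose 2)) \<le> 62 * card V + 58"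
    using neighbourhood_partition[OF G x min] by blast
  obtain E' where G': "simple_graph (V - {x}) E'"
    and cp: "cp V E \<le> card P + cp (V - {x}) E'"
    and e: "card E = card E' + (\<Sum>p\<in>P. Suc (card p) choose 2)"
    using peel_vertex[OF G x P(1,2)] by blast
  have k: "k = card (V - {x})" using Suc.hyps(2) x finV by simp
  have "120 * cp (V - {x}) E' + 4 * card E' \<le> 31 * k\<^sup>2 + 100 * k"
    using Suc.hyps(1)[OF k G'] k by simp
  moreover have "4 * (\<Sum>p\<in>P. 30 + (Suc (card p) choose 2))
      = 120 * card P + 4 * (\<Sum>p\<in>P. Suc (card p) choose 2)"
    by (simp only: sum.distrib sum_constant) simp
  moreover have "31 * (card V)\<^sup>2 + 100 * card V = 31 * k\<^sup>2 + 100 * k + 62 * k + 131"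
    by (simp add: Suc.hyps(2)[symmetric] power2_eq_square algebra_simps)
  ultimately show ?case using P(3) cp e Suc.hyps(2) by linarith
qed

section \<open>Making the graph triangle-free\<close>

definition triangle_free :: "'a set set \<Rightarrow> bool" where
  "triangle_free H \<longleftrightarrow> (\<forall>u v w. {u, v} \<in> H \<longrightarrow> {v, w} \<in> H \<longrightarrow> {u, w} \<notin> H)"

text \<open>The set \<open>R\<close> consists of the edges of a maximal family of edge-disjoint triangles. A
  partition into these triangles and the remaining single edges saves two members per triangle,
  hence two for every three edges of \<open>R\<close>.\<close>
lemma triangle_removal:
  assumes G: "simple_graph V E"
  obtains R where "R \<subseteq> E" "3 * cp V E + 2 * card R \<le> 3 * card E"
    "triangle_free (E - R)"
proof -
  have finV: "finite V" using G by (simp add: simple_graph_def)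
  define packing where "packing \<T> \<longleftrightarrow> clique_family V E \<T> \<and>
    disjoint_family_on (edges_within E) \<T> \<and> (\<forall>t\<in>\<T>. card t = 3)" for \<T>
  have "packing {}" by (simp add: packing_def clique_family_def disjoint_family_on_def)
  moreover have "\<forall>\<T>. packing \<T> \<longrightarrow> card \<T> < Suc (card (Pow V))"
    using finV by (auto simp: packing_def clique_family_def less_Suc_eq_le intro!: card_mono)
  ultimately obtain \<T> where T: "packing \<T>" and mx: "\<And>\<T>'. packing \<T>' \<Longrightarrow> card \<T>' \<le> card \<T>"
    using ex_has_greatest_nat[of packing "{}" card] by metis
  have fam: "clique_family V E \<T>" and dis: "disjoint_family_on (edges_within E) \<T>"
    using T by (auto simp: packing_def)
  have finT: "finite \<T>" by (rule finite_clique_family[OF finV fam])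
  define R where "R = (\<Union>t\<in>\<T>. edges_within E t)"
  have RE: "R \<subseteq> E" by (auto simp: R_def edges_within_def)
  have finE: "finite E" by (rule simple_graph_finite_edges[OF G])
  have cR: "card R = 3 * card \<T>"
    using card_edges_of_disjoint_cliques[OF G fam dis] T
    by (simp add: R_def packing_def choose_two)
  have G': "simple_graph V (E - R)" by (rule simple_graph_subset[OF G]) auto
  have "cp V E \<le> card \<T> + cp V (E - R)"
    by (rule cp_le_add_remainder[OF G fam dis _ _ G']) (auto simp: R_def)
  also have "cp V (E - R) \<le> card (E - R)" by (rule cp_le_card_edges[OF G'])
  also have "card (E - R) = card E - card R"
    using RE finE by (simp add: card_Diff_subset finite_subset)
  finally have "3 * cp V E + 2 * card R \<le> 3 * card E"
    using cR card_mono[OF finE RE] by linarith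
  moreover have False if uvw: "{u, v} \<in> E - R" "{v, w} \<in> E - R" "{u, w} \<in> E - R" for u v w
  proof -
    have ne: "u \<noteq> v" "v \<noteq> w" "u \<noteq> w"
      using simple_graph_edge[OF G, of "{u, v}"] simple_graph_edge[OF G, of "{v, w}"]
        simple_graph_edge[OF G, of "{u, w}"] uvw by auto
    have cl: "clique {u, v, w} E" using uvw by (auto simp: clique_def insert_commute)
    have new: "edges_within E {u, v, w} \<inter> R = {}"
    proof -
      have "e \<in> {{u, v}, {v, w}, {u, w}}" if e: "e \<in> edges_within E {u, v, w}" for e
      proof -
        have "card e = 2" "e \<subseteq> {u, v, w}"
          using e simple_graph_edge[OF G] by (auto simp: edges_within_def)
        then show ?thesis by (auto simp: card_2_iff insert_commute)
      qed
      then show ?thesis using uvw by blast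
    qed
    have uvE: "{u, v} \<in> edges_within E {u, v, w}" using uvw by (simp add: edges_within_def)
    have nT: "{u, v, w} \<notin> \<T>" using uvE new by (auto simp: R_def)
    have "edges_within E {u, v, w} \<inter> edges_within E t = {}" if "t \<in> \<T>" for t
      using new that by (auto simp: R_def)
    then have "disjoint_family_on (edges_within E) (insert {u, v, w} \<T>)"
      using dis by (simp add: disjoint_family_on_def) blast
    moreover have "{u, v, w} \<subseteq> V"
      using simple_graph_edge[OF G, of "{u, v}"] simple_graph_edge[OF G, of "{v, w}"] uvw by auto
    ultimately have "packing (insert {u, v, w} \<T>)"
      using T cl ne by (simp add: packing_def clique_family_def)
    then show False using mx[of "insert {u, v, w} \<T>"] nT finT by simp
  qed
  ultimately show ?thesis using that[OF RE] unfolding triangle_free_def by blast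
qed

lemma card_incident_edges:
  assumes G: "simple_graph V E"
  shows "card {e \<in> E. z \<in> e} = card (nbhd E z)"
proof -
  have "{e \<in> E. z \<in> e} = (\<lambda>y. {z, y}) ` nbhd E z"
  proof (intro equalityI subsetI)
    fix e assume e: "e \<in> {e \<in> E. z \<in> e}"
    then obtain y where "e = {z, y}"
      using simple_graph_edge[OF G, of e] by (auto simp: card_2_iff insert_commute)
    then show "e \<in> (\<lambda>y. {z, y}) ` nbhd E z" using e by (auto simp: nbhd_def)
  qed (auto simp: nbhd_def)
  moreover have "inj_on (\<lambda>y. {z, y}) (nbhd E z)"
    by (auto simp: inj_on_def doubleton_eq_iff)
  ultimately show ?thesis by (simp add: card_image)
qed

lemma sum_over_edge_ends:
  fixes g :: "'a \<Rightarrow> nat"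
  assumes G: "simple_graph V E"
  shows "(\<Sum>e\<in>E. \<Sum>z\<in>e. g z) = (\<Sum>z\<in>V. card (nbhd E z) * g z)"
proof -
  have fin: "finite V" "finite E"
    using G simple_graph_finite_edges by (auto simp: simple_graph_def)
  have "(\<Sum>e\<in>E. \<Sum>z\<in>e. g z) = (\<Sum>e\<in>E. \<Sum>z | z \<in> V \<and> z \<in> e. g z)"
    using simple_graph_edge[OF G] by (intro sum.cong refl) auto
  also have "\<dots> = (\<Sum>z\<in>V. \<Sum>e | e \<in> E \<and> z \<in> e. g z)"
    by (rule sum.swap_restrict[OF fin(2,1)])
  also have "\<dots> = (\<Sum>z\<in>V. card (nbhd E z) * g z)"
    using card_incident_edges[OF G] by simp
  finally show ?thesis .
qed

lemma handshake:
  assumes G: "simple_graph V E"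
  shows "(\<Sum>z\<in>V. card (nbhd E z)) = 2 * card E"
  using sum_over_edge_ends[OF G, of "\<lambda>_. 1"] simple_graph_edge[OF G] by simp

text \<open>Let \<open>e = {u, v}\<close>. A vertex \<open>w\<close> of the clique that is joined by \<open>R\<close> neither to \<open>u\<close> nor to
  \<open>v\<close> would form a triangle with them outside \<open>R\<close>.\<close>
lemma edge_in_large_clique:
  assumes G: "simple_graph V E" and R: "R \<subseteq> E"
    and tf: "triangle_free (E - R)"
    and Q: "clique Q E" "Q \<subseteq> V" and e: "e \<in> E - R" "e \<subseteq> Q"
  shows "card Q \<le> (\<Sum>z\<in>e. card (nbhd R z)) + 2"
proof -
  obtain u v where uv: "e = {u, v}" "u \<noteq> v"
    using simple_graph_edge[OF G, of e] e by (auto simp: card_2_iff)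
  have fin: "finite Q" "finite (nbhd R u)" "finite (nbhd R v)"
    using Q(2) finite_nbhd[OF simple_graph_subset[OF G R]] G
    by (auto simp: simple_graph_def intro: finite_subset)
  have "Q \<subseteq> (nbhd R u \<union> nbhd R v) \<union> {u, v}"
  proof
    fix w assume w: "w \<in> Q"
    show "w \<in> (nbhd R u \<union> nbhd R v) \<union> {u, v}"
    proof (rule ccontr)
      assume no: "\<not> ?thesis"
      then have "{v, w} \<in> E" "{u, w} \<in> E"
        using Q(1) w e(2) uv by (auto simp: clique_def)
      then show False using tf no e(1) uv by (auto simp: nbhd_def triangle_free_def)
    qed
  qed
  then have "card Q \<le> card ((nbhd R u \<union> nbhd R v) \<union> {u, v})"
    using fin by (intro card_mono) auto
  also have "\<dots> \<le> card (nbhd R u \<union> nbhd R v) + card {u, v}" by (rule card_Un_le)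
  also have "\<dots> \<le> card (nbhd R u) + card (nbhd R v) + 2"
    using card_Un_le[of "nbhd R u" "nbhd R v"] uv by simp
  finally show ?thesis using uv by simp
qed

text \<open>The cliques with at most \<open>s + 1\<close> vertices account for the first term on the right. For
  every other edge of \<open>E - R\<close> the degrees of its ends in \<open>R\<close> add up to at least \<open>s\<close>; summed over
  all edges, each vertex contributes its degree in \<open>R\<close> at most \<open>card V\<close> times.\<close>
lemma triangle_hitting_lower_bound:
  assumes G: "simple_graph V E" and R: "R \<subseteq> E"
    and tf: "triangle_free (E - R)"
    and C: "clique_cover V E \<C>"
  shows "s * card (E - R) \<le> s * (card \<C> * (Suc s choose 2)) + 2 * card V * card R"
proof -
  define H where "H = E - R"
  define H0 where "H0 = (\<Union>Q\<in>{Q \<in> \<C>. card Q \<le> Suc s}. edges_within H Q)"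
  have fin: "finite V" "finite E" "finite H" "finite \<C>"
    using G simple_graph_finite_edges[OF G] C finite_clique_family
    by (auto simp: simple_graph_def clique_cover_def H_def)
  have GH: "simple_graph V H" by (rule simple_graph_subset[OF G]) (auto simp: H_def)
  have GR: "simple_graph V R" by (rule simple_graph_subset[OF G R])
  have cl: "clique Q E" "Q \<subseteq> V" if "Q \<in> \<C>" for Q
    using C that by (auto simp: clique_cover_def clique_family_def)
  have finQ: "finite Q" if "Q \<in> \<C>" for Q by (rule finite_subset[OF cl(2)[OF that] fin(1)])
  have "card (edges_within H Q) \<le> Suc s choose 2" if Q: "Q \<in> \<C>" "card Q \<le> Suc s" for Q
  proof -
    have "edges_within H Q \<subseteq> edges_within E Q" by (auto simp: edges_within_def H_def)
    then have "edges_within H Q \<subseteq> [Q]\<^bsup>2\<^esup>"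
      using edges_within_clique[OF G cl(1)[OF Q(1)]] by simp
    then have "card (edges_within H Q) \<le> card ([Q]\<^bsup>2\<^esup>)"
      by (intro card_mono finite_imp_finite_nsets finQ Q(1))
    also have "\<dots> \<le> Suc s choose 2"
      using binomial_right_mono[OF Q(2), of 2] by (simp add: card_nsets)
    finally show ?thesis .
  qed
  then have "card H0 \<le> (\<Sum>Q\<in>{Q \<in> \<C>. card Q \<le> Suc s}. Suc s choose 2)"
    unfolding H0_def using fin by (intro order_trans[OF card_UN_le] sum_mono) auto
  also have "\<dots> \<le> card \<C> * (Suc s choose 2)"
    using fin card_mono[of \<C> "{Q \<in> \<C>. card Q \<le> Suc s}"] by simp
  finally have H0: "card H0 \<le> card \<C> * (Suc s choose 2)" .
  have H0H: "H0 \<subseteq> H" by (auto simp: H0_def edges_within_def)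
  have large: "s \<le> (\<Sum>z\<in>e. card (nbhd R z))" if e: "e \<in> H - H0" for e
  proof -
    have eE: "e \<in> E - R" using e by (simp add: H_def)
    then obtain Q where Q: "Q \<in> \<C>" "e \<subseteq> Q"
      using C by (auto simp: clique_cover_def edges_within_def)
    then have "\<not> card Q \<le> Suc s" using e by (auto simp: H0_def edges_within_def)
    then show ?thesis
      using edge_in_large_clique[OF G R tf cl(1)[OF Q(1)] cl(2)[OF Q(1)] eE Q(2)] by simp
  qed
  have "s * card (H - H0) = (\<Sum>e\<in>H - H0. s)" by simp
  also have "\<dots> \<le> (\<Sum>e\<in>H - H0. \<Sum>z\<in>e. card (nbhd R z))" by (rule sum_mono[OF large])
  also have "\<dots> \<le> (\<Sum>e\<in>H. \<Sum>z\<in>e. card (nbhd R z))"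
    using fin by (intro sum_mono2) auto
  also have "\<dots> = (\<Sum>z\<in>V. card (nbhd H z) * card (nbhd R z))"
    by (rule sum_over_edge_ends[OF GH])
  also have "\<dots> \<le> (\<Sum>z\<in>V. card V * card (nbhd R z))"
  proof (intro sum_mono mult_right_mono)
    show "card (nbhd H z) \<le> card V" for z
      using nbhd_subset[OF GH, of z] fin by (intro card_mono) auto
  qed simp
  also have "\<dots> = 2 * card V * card R"
    using handshake[OF GR] by (simp add: sum_distrib_left[symmetric])
  finally have "s * card (H - H0) \<le> 2 * card V * card R" .
  moreover have "card H = card H0 + card (H - H0)"
    using H0H fin by (metis card_Diff_subset card_mono finite_subset le_add_diff_inverse)
  moreover have "s * card H0 \<le> s * (card \<C> * (Suc s choose 2))"
    by (intro mult_left_mono H0) simp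
  ultimately show ?thesis by (simp only: H_def[symmetric] add_mult_distrib2)
qed

section \<open>The upper bound\<close>

text \<open>Here \<open>X\<close> is the cube root of the number of vertices, so all quantities become polynomials
  in \<open>X\<close>.\<close>
lemma gap_upper_bound:
  fixes X :: real
  assumes G: "simple_graph V E" and n: "real (card V) = X ^ 3" and X: "X \<ge> 1000"
  shows "real (cp V E) - real (cc V E) \<le> X ^ 6 / 4 - X ^ 4 / 1000 - 1"
proof (rule ccontr)
  assume "\<not> ?thesis"
  then have gap: "real (cp V E) - real (cc V E) > X ^ 6 / 4 - X ^ 4 / 1000 - 1" by simp
  define p e m where "p = real (cp V E)" and "e = real (card E)" and "m = real (cc V E)"
  have X3: "X ^ 3 \<ge> 1000000" using power_mono[OF X, of 3] by simp
  have X4: "X ^ 4 \<ge> 1000 * X ^ 3" using X by (simp add: power_numeral_reduce mult_right_mono)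
  have X6: "X ^ 6 \<ge> 1000000 * X ^ 4"
  proof -
    have "1000000 \<le> X ^ 2" using power_mono[OF X, of 2] by simp
    then have "1000000 * X ^ 4 \<le> X ^ 2 * X ^ 4" using X by (intro mult_right_mono) auto
    then show ?thesis by (simp add: power_add[symmetric])
  qed
  have pe: "p \<le> e" using cp_le_card_edges[OF G] by (simp add: p_def e_def)
  have "real (120 * cp V E + 4 * card E) \<le> real (31 * (card V)\<^sup>2 + 100 * card V)"
    using cp_edges_tradeoff[OF G] of_nat_mono by blast
  then have trade: "120 * p + 4 * e \<le> 31 * X ^ 6 + 100 * X ^ 3"
    by (simp add: p_def e_def n power_mult[symmetric])
  have gap': "p - m > X ^ 6 / 4 - X ^ 4 / 1000 - 1" using gap by (simp add: p_def m_def)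
  have m: "m \<le> X ^ 4 / 450"
    using gap' trade pe X3 X4 by linarith
  have m0: "m \<ge> 0" by (simp add: m_def)
  obtain R where R: "R \<subseteq> E" and R2: "3 * cp V E + 2 * card R \<le> 3 * card E"
    and tf: "triangle_free (E - R)"
    using triangle_removal[OF G] by blast
  define r where "r = real (card R)"
  have "real (3 * cp V E + 2 * card R) \<le> real (3 * card E)"
    using R2 of_nat_mono by blast
  then have "3 * p + 2 * r \<le> 3 * e" by (simp add: p_def e_def r_def)
  then have r: "r \<le> X ^ 4 / 10" using gap' trade m0 X3 X4 by linarith
  have finE: "finite E" by (rule simple_graph_finite_edges[OF G])
  have H: "real (card (E - R)) \<ge> X ^ 6 / 5"
  proof -
    have "card (E - R) = card E - card R" "card R \<le> card E"
      using R finE by (simp_all add: card_Diff_subset finite_subset card_mono)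
    then have "real (card (E - R)) = e - r" by (simp add: e_def r_def)
    then show ?thesis using pe gap' m0 r X6 X3 X4 by linarith
  qed
  \<comment> \<open>As \<open>Suc s choose 2 \<le> 45 X\<^sup>2\<close> and \<open>m \<le> X\<^sup>4/450\<close>, the cliques with at most \<open>s + 1\<close> vertices
    contain at most \<open>X\<^sup>6/10\<close> edges, half of the guaranteed \<open>X\<^sup>6/5\<close> edges outside \<open>R\<close>.\<close>
  define s where "s = nat \<lfloor>9 * X\<rfloor>"
  have s: "real s \<le> 9 * X" "real s \<ge> 8 * X" using X by (simp_all add: s_def) linarith+
  obtain \<C> where C: "clique_cover V E \<C>" "card \<C> = cc V E" using cc_attained[OF G] .
  have c2: "real (Suc s choose 2) \<le> 45 * X ^ 2"
  proof -
    have "2 * real (Suc s choose 2) = real (2 * (Suc s choose 2))" by simp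
    also have "\<dots> = real s * (real s + 1)"
      unfolding two_times_choose_two by (simp add: algebra_simps)
    also have "\<dots> \<le> (9 * X) * (10 * X)" using s X by (intro mult_mono) auto
    finally show ?thesis by (simp add: power2_eq_square)
  qed
  have "m * real (Suc s choose 2) \<le> (X ^ 4 / 450) * (45 * X ^ 2)"
    using m c2 m0 by (intro mult_mono) auto
  also have "\<dots> = X ^ 6 / 10" by (simp add: power_add[symmetric])
  finally have small: "m * real (Suc s choose 2) \<le> X ^ 6 / 10" .
  have "real (s * card (E - R)) \<le> real (s * (card \<C> * (Suc s choose 2)) + 2 * card V * card R)"
    using triangle_hitting_lower_bound[OF G R tf C(1), where s = s] of_nat_mono by blast
  then have "real s * real (card (E - R)) \<le> real s * (m * real (Suc s choose 2)) + 2 * X ^ 3 * r"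
    by (simp add: m_def r_def n C(2))
  then have "real s * (real (card (E - R)) - m * real (Suc s choose 2)) \<le> 2 * X ^ 3 * r"
    by (simp add: algebra_simps)
  moreover have "2 * X ^ 3 * r \<le> 2 * X ^ 3 * (X ^ 4 / 10)"
    using r X by (intro mult_left_mono) auto
  moreover have "(8 * X) * (X ^ 6 / 10) \<le> real s * (real (card (E - R)) - m * real (Suc s choose 2))"
    using s small H X by (intro mult_mono) auto
  ultimately have "(8 * X) * (X ^ 6 / 10) \<le> 2 * X ^ 3 * (X ^ 4 / 10)" by linarith
  then have "X ^ 7 \<le> 0" by (simp add: power_numeral_reduce)
  then show False using X zero_less_power[of X 7] by linarith
qed

section \<open>The lower bound\<close>

text \<open>Twice the difference of the two sides is \<open>(s - t)\<^sup>2 + (s - 1)\<^sup>2 + (t - 1)\<^sup>2\<close>.\<close>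
lemma product_le_quadratic: "s * t \<le> 1 + 2 * ((s choose 2) + (t choose 2))"
proof -
  have int: "int (a * (a - 1)) = int a * (int a - 1)" for a :: nat
    by (cases a) (auto simp: algebra_simps)
  have "2 * (int s * int t) \<le> 2 * (1 + int s * (int s - 1) + int t * (int t - 1))"
    using zero_le_power2[of "int s - int t"] zero_le_power2[of "int s - 1"]
      zero_le_power2[of "int t - 1"]
    by (simp add: power2_eq_square algebra_simps)
  then have "int (s * t) \<le> int (1 + s * (s - 1) + t * (t - 1))"
    unfolding of_nat_add int by simp
  then have "s * t \<le> 1 + s * (s - 1) + t * (t - 1)" by (simp only: of_nat_le_iff)
  then show ?thesis
    by (simp only: two_times_choose_two[symmetric] add_mult_distrib2 add.assoc)
qed

text \<open>Sum \<open>product_le_quadratic\<close> over a minimum clique partition: every pair in \<open>A \<times> B\<close> is an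
  edge of some member, and no edge inside \<open>A\<close> or \<open>B\<close> is counted for two members.\<close>
lemma complete_bipartition_partition_bound:
  assumes G: "simple_graph (A \<union> B) E" and AB: "A \<inter> B = {}"
    and cross: "\<And>a b. a \<in> A \<Longrightarrow> b \<in> B \<Longrightarrow> {a, b} \<in> E"
  shows "card A * card B \<le> cp (A \<union> B) E + 2 * card {e \<in> E. e \<subseteq> A \<or> e \<subseteq> B}"
proof -
  obtain \<C> where C: "clique_partition (A \<union> B) E \<C>" and cC: "card \<C> = cp (A \<union> B) E"
    using cp_attained[OF G] .
  have fin: "finite A" "finite B" "finite E" "finite \<C>"
    using G simple_graph_finite_edges[OF G] finite_clique_family[of "A \<union> B" E \<C>] C
    by (auto simp: simple_graph_def clique_partition_def)
  define I where "I = {e \<in> E. e \<subseteq> A \<or> e \<subseteq> B}"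
  have inner: "(card (Q \<inter> A) choose 2) + (card (Q \<inter> B) choose 2) \<le> card (edges_within E Q \<inter> I)"
    if Q: "Q \<in> \<C>" for Q
  proof -
    have cl: "clique (Q \<inter> S) E" for S
      using C Q by (auto simp: clique_partition_def clique_family_def clique_def)
    have sub: "[Q \<inter> A]\<^bsup>2\<^esup> \<union> [Q \<inter> B]\<^bsup>2\<^esup> \<subseteq> edges_within E Q \<inter> I"
      using edges_within_clique[OF G cl[of A]] edges_within_clique[OF G cl[of B]]
      by (auto simp: edges_within_def I_def)
    have dis: "[Q \<inter> A]\<^bsup>2\<^esup> \<inter> [Q \<inter> B]\<^bsup>2\<^esup> = {}"
    proof -
      have "card e \<noteq> 2" if "e \<subseteq> Q" "e \<subseteq> A" "e \<subseteq> B" for e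
      proof -
        have "e \<subseteq> A \<inter> B" using that by auto
        then show ?thesis using AB by simp
      qed
      then show ?thesis by (auto simp: nsets_def)
    qed
    have "(card (Q \<inter> A) choose 2) + (card (Q \<inter> B) choose 2)
        = card ([Q \<inter> A]\<^bsup>2\<^esup> \<union> [Q \<inter> B]\<^bsup>2\<^esup>)"
      using fin dis by (subst card_Un_disjoint) (auto simp: finite_imp_finite_nsets card_nsets)
    also have "\<dots> \<le> card (edges_within E Q \<inter> I)"
      using fin sub by (intro card_mono) (auto simp: I_def)
    finally show ?thesis .
  qed
  have "A \<times> B \<subseteq> (\<Union>Q\<in>\<C>. (Q \<inter> A) \<times> (Q \<inter> B))"
  proof clarify
    fix a b assume ab: "a \<in> A" "b \<in> B"
    then have "{a, b} \<in> (\<Union>Q\<in>\<C>. edges_within E Q)"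
      using cross[OF ab] C by (auto simp: clique_partition_def)
    then show "(a, b) \<in> (\<Union>Q\<in>\<C>. (Q \<inter> A) \<times> (Q \<inter> B))"
      using ab by (auto simp: edges_within_def)
  qed
  then have "card (A \<times> B) \<le> card (\<Union>Q\<in>\<C>. (Q \<inter> A) \<times> (Q \<inter> B))"
    using fin by (intro card_mono) auto
  also have "\<dots> \<le> (\<Sum>Q\<in>\<C>. card ((Q \<inter> A) \<times> (Q \<inter> B)))"
    by (rule card_UN_le[OF fin(4)])
  also have "\<dots> \<le> (\<Sum>Q\<in>\<C>. 1 + 2 * card (edges_within E Q \<inter> I))"
  proof (rule sum_mono)
    fix Q assume "Q \<in> \<C>"
    then show "card ((Q \<inter> A) \<times> (Q \<inter> B)) \<le> 1 + 2 * card (edges_within E Q \<inter> I)"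
      using inner[of Q] product_le_quadratic[of "card (Q \<inter> A)" "card (Q \<inter> B)"]
      by (simp add: card_cartesian_product)
  qed
  also have "\<dots> = card \<C> + 2 * (\<Sum>Q\<in>\<C>. card (edges_within E Q \<inter> I))"
    by (simp only: sum.distrib sum_distrib_left[symmetric]) simp
  also have "(\<Sum>Q\<in>\<C>. card (edges_within E Q \<inter> I)) = card (\<Union>Q\<in>\<C>. edges_within E Q \<inter> I)"
  proof (rule card_UN_disjoint[symmetric])
    show "\<forall>P\<in>\<C>. \<forall>Q\<in>\<C>. P \<noteq> Q \<longrightarrow> (edges_within E P \<inter> I) \<inter> (edges_within E Q \<inter> I) = {}"
      using C unfolding clique_partition_def disjoint_family_on_def by blast
  qed (use fin in \<open>auto simp: I_def\<close>)
  also have "\<dots> \<le> card I"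
    using fin by (intro card_mono) (auto simp: I_def)
  finally show ?thesis by (simp add: card_cartesian_product cC I_def)
qed

text \<open>The blocks are the fibres of \<open>\<lambda>i. i div k\<close> inside \<open>{..<h}\<close> and inside \<open>{h..<n}\<close>. The
  threshold \<open>h\<close> may cut such a fibre in two; the pieces lie in different halves, so all their
  vertices are adjacent.\<close>
definition block_graph :: "nat \<Rightarrow> nat \<Rightarrow> nat \<Rightarrow> nat set set" where
  "block_graph n h k =
     {{i, j} |i j. i < n \<and> j < n \<and> i \<noteq> j \<and> ((i < h) \<noteq> (j < h) \<or> i div k = j div k)}"

lemma block_graph_edge:
  "{i, j} \<in> block_graph n h k \<longleftrightarrow>
     i < n \<and> j < n \<and> i \<noteq> j \<and> ((i < h) \<noteq> (j < h) \<or> i div k = j div k)"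
  by (auto simp: block_graph_def doubleton_eq_iff)

lemma simple_block_graph: "simple_graph {..<n} (block_graph n h k)"
  by (auto simp: simple_graph_def block_graph_def nsets_def)

lemma cc_block_graph: "cc {..<n} (block_graph n h k) \<le> (Suc (n div k))\<^sup>2"
proof -
  define Q where "Q = (\<lambda>(a, b). {i. i < n \<and> i < h \<and> i div k = a} \<union> {j. j < n \<and> h \<le> j \<and> j div k = b})"
  define \<C> where "\<C> = Q ` ({..n div k} \<times> {..n div k})"
  have "clique_family {..<n} (block_graph n h k) \<C>"
    by (auto simp: clique_family_def \<C>_def Q_def clique_def block_graph_edge)
  moreover have "e \<in> (\<Union>Q\<in>\<C>. edges_within (block_graph n h k) Q)" if e: "e \<in> block_graph n h k" for e
  proof -
    obtain i j where ij: "e = {i, j}" "i < n" "j < n" "(i < h) \<noteq> (j < h) \<or> i div k = j div k"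
      using e by (auto simp: block_graph_def)
    have le: "i div k \<le> n div k" "j div k \<le> n div k"
      using ij by (auto intro: div_le_mono)
    have "\<exists>a b. a \<le> n div k \<and> b \<le> n div k \<and> i \<in> Q (a, b) \<and> j \<in> Q (a, b)"
    proof (cases "i < h")
      case True
      then show ?thesis using ij le
        by (intro exI[of _ "i div k"] exI[of _ "j div k"]) (auto simp: Q_def)
    next
      case False
      then show ?thesis using ij le
        by (intro exI[of _ "j div k"] exI[of _ "i div k"]) (auto simp: Q_def)
    qed
    then show ?thesis using e ij(1) by (force simp: \<C>_def edges_within_def)
  qed
  ultimately have "cc {..<n} (block_graph n h k) \<le> card \<C>"
    by (intro cc_le simple_block_graph) (auto simp: clique_cover_def)
  also have "\<dots> \<le> card ({..n div k} \<times> {..n div k})"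
    unfolding \<C>_def by (rule card_image_le) simp
  finally show ?thesis by (simp add: power2_eq_square)
qed

lemma cp_block_graph:
  assumes "h \<le> n" "k > 0"
  shows "h * (n - h) \<le> cp {..<n} (block_graph n h k) + 2 * (n * k)"
proof -
  let ?E = "block_graph n h k"
  define I where "I = {e \<in> ?E. e \<subseteq> {..<h} \<or> e \<subseteq> {h..<n}}"
  have V: "{..<n} = {..<h} \<union> {h..<n}" using assms by auto
  have "card {..<h} * card {h..<n} \<le> cp ({..<h} \<union> {h..<n}) ?E + 2 * card I"
    unfolding I_def
  proof (rule complete_bipartition_partition_bound)
    show "simple_graph ({..<h} \<union> {h..<n}) ?E"
      using simple_block_graph[of n h k] by (simp only: V)
    show "{a, b} \<in> ?E" if "a \<in> {..<h}" "b \<in> {h..<n}" for a b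
      using that assms(1) by (auto simp: block_graph_edge)
  qed auto
  moreover have "card I \<le> n * k"
  proof -
    have "I \<subseteq> (\<lambda>(i, j). {i, j}) ` (SIGMA i:{..<n}. {i div k * k..<i div k * k + k})"
    proof
      fix e assume e: "e \<in> I"
      then obtain i j where ij: "e = {i, j}" "i < n" "i div k = j div k"
        by (auto simp: I_def block_graph_def)
      have "j \<in> {i div k * k..<i div k * k + k}"
        using dividend_less_div_times[OF assms(2), of j] by (simp add: ij(3) add.commute)
      then show "e \<in> (\<lambda>(i, j). {i, j}) ` (SIGMA i:{..<n}. {i div k * k..<i div k * k + k})"
        using ij by force
    qed
    then have "card I \<le> card (SIGMA i:{..<n}. {i div k * k..<i div k * k + k})"
      by (intro surj_card_le) auto
    then show ?thesis by simp
  qed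
  ultimately show ?thesis by (simp add: V)
qed

text \<open>The choice \<open>k \<approx> X\<close> balances the cover, about \<open>(n/k)\<^sup>2\<close> cliques, against the \<open>n k\<close> edges
  inside blocks.\<close>
lemma gap_lower_bound:
  fixes X :: real
  assumes n: "real n = X ^ 3" and X: "X \<ge> 1"
  obtains E where "simple_graph {..<n} E"
    "\<lfloor>(real n)\<^sup>2 / 4\<rfloor> - 8 * X ^ 4 \<le> real (cp {..<n} E) - real (cc {..<n} E)"
proof -
  define k h where "k = nat \<lceil>X\<rceil>" and "h = n div 2"
  let ?E = "block_graph n h k"
  have k: "real k \<ge> X" "real k \<le> 2 * X" using X by (simp_all add: k_def) linarith+
  have k0: "k > 0" using k X by linarith
  have "real (n div k) \<le> real n / real k" by (rule of_nat_div_le_of_nat)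
  also have "\<dots> \<le> X ^ 3 / X" using k X n by (intro frac_le) auto
  also have "\<dots> = X ^ 2" using X by (simp add: power_numeral_reduce)
  finally have "real (Suc (n div k)) \<le> 2 * X ^ 2"
    using one_le_power[OF X, of 2] by simp
  then have "(real (Suc (n div k)))\<^sup>2 \<le> (2 * X ^ 2)\<^sup>2" by (intro power_mono) auto
  moreover have "real (cc {..<n} ?E) \<le> real ((Suc (n div k))\<^sup>2)"
    using cc_block_graph of_nat_mono by blast
  ultimately have cc: "real (cc {..<n} ?E) \<le> 4 * X ^ 4"
    by (simp add: power_mult_distrib power_mult[symmetric])
  have nk: "real (n * k) \<le> 2 * X ^ 4"
  proof -
    have "real n * real k \<le> X ^ 3 * (2 * X)" using k n X by (intro mult_mono) auto
    then show ?thesis by (simp add: power_numeral_reduce)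
  qed
  have "real_of_int \<lfloor>(real n)\<^sup>2 / 4\<rfloor> \<le> real (h * (n - h))"
  proof -
    have "n ^ 2 \<le> 4 * (h * (n - h)) + 1"
    proof (cases "even n")
      case True
      then obtain q where "n = 2 * q" by blast
      then show ?thesis by (simp add: h_def power2_eq_square)
    next
      case False
      then obtain q where "n = 2 * q + 1" using oddE by blast
      then show ?thesis by (simp add: h_def power2_eq_square algebra_simps)
    qed
    then have "real (n ^ 2) \<le> real (4 * (h * (n - h)) + 1)" using of_nat_mono by blast
    then have "(real n)\<^sup>2 / 4 < real (h * (n - h)) + 1" by simp
    then have "\<lfloor>(real n)\<^sup>2 / 4\<rfloor> \<le> int (h * (n - h))" by (subst floor_le_iff) simp
    then have "real_of_int \<lfloor>(real n)\<^sup>2 / 4\<rfloor> \<le> real_of_int (int (h * (n - h)))"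
      by (simp only: of_int_le_iff)
    then show ?thesis by (simp only: of_int_of_nat_eq)
  qed
  moreover have "real (h * (n - h)) \<le> real (cp {..<n} ?E + 2 * (n * k))"
    unfolding of_nat_le_iff by (rule cp_block_graph[OF _ k0]) (simp add: h_def)
  ultimately have "\<lfloor>(real n)\<^sup>2 / 4\<rfloor> - 8 * X ^ 4 \<le> real (cp {..<n} ?E) - real (cc {..<n} ?E)"
    using cc nk by (simp only: of_nat_add of_nat_mult of_nat_numeral)
  then show ?thesis using that simple_block_graph by blast
qed

theorem theorem1p2:
  shows "\<exists>C1 C2 :: real. C1 > 0 \<and> C2 > 0 \<and>
    (\<forall>\<^sub>F n in sequentially.
       real_of_int \<lfloor>(real n)\<^sup>2 / 4\<rfloor> - C1 * real n powr (4/3) \<le> real_of_int (max_cp_cc_gap n) \<and>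
       real_of_int (max_cp_cc_gap n) \<le> real_of_int \<lfloor>(real n)\<^sup>2 / 4\<rfloor> - C2 * real n powr (4/3))"
proof (intro exI conjI)
  show "\<forall>\<^sub>F n in sequentially.
       real_of_int \<lfloor>(real n)\<^sup>2 / 4\<rfloor> - 8 * real n powr (4/3) \<le> real_of_int (max_cp_cc_gap n) \<and>
       real_of_int (max_cp_cc_gap n) \<le> real_of_int \<lfloor>(real n)\<^sup>2 / 4\<rfloor> - 1/1000 * real n powr (4/3)"
    using eventually_ge_at_top[of "1000 ^ 3"]
  proof eventually_elim
    fix n :: nat assume N: "1000 ^ 3 \<le> n"
    define X where "X = real n powr (1/3)"
    have pos: "real n > 0" using N by simp
    have X3: "real n = X ^ 3" and X4: "real n powr (4/3) = X ^ 4"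
      using pos by (simp_all add: X_def powr_power)
    have X: "X \<ge> 1000"
    proof (rule power_le_imp_le_base)
      have "real (1000 ^ 3) \<le> real n" using N of_nat_mono by blast
      then show "1000 ^ Suc 2 \<le> X ^ Suc 2" using X3 by simp
    qed (simp add: X_def)
    let ?S = "{int (cp V E) - int (cc V E) |(V :: nat set) E. simple_graph V E \<and> card V = n}"
    have lower: "\<lfloor>(real n)\<^sup>2 / 4\<rfloor> - 8 * X ^ 4 \<le> max_cp_cc_gap n"
    proof -
      obtain E where E: "simple_graph {..<n} E"
        "\<lfloor>(real n)\<^sup>2 / 4\<rfloor> - 8 * X ^ 4 \<le> real (cp {..<n} E) - real (cc {..<n} E)"
        using gap_lower_bound[OF X3] X by auto
      have "int (cp {..<n} E) - int (cc {..<n} E) \<in> ?S" using E(1) by fastforce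
      then have "int (cp {..<n} E) - int (cc {..<n} E) \<le> max_cp_cc_gap n"
        unfolding max_cp_cc_gap_def by (rule Max_ge[OF gap_values_finite])
      then show ?thesis using E(2) by linarith
    qed
    have upper: "max_cp_cc_gap n \<le> \<lfloor>(real n)\<^sup>2 / 4\<rfloor> - 1/1000 * X ^ 4"
    proof -
      have "max_cp_cc_gap n \<in> ?S"
        unfolding max_cp_cc_gap_def by (rule Max_in[OF gap_values_finite gap_values_nonempty])
      then obtain V :: "nat set" and E where VE: "simple_graph V E" "card V = n"
        "max_cp_cc_gap n = int (cp V E) - int (cc V E)" by blast
      then have "max_cp_cc_gap n \<le> X ^ 6 / 4 - X ^ 4 / 1000 - 1"
        using gap_upper_bound[OF VE(1) _ X] X3 by simp
      moreover have "(real n)\<^sup>2 / 4 = X ^ 6 / 4" by (simp add: X3 power_mult[symmetric])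
      ultimately show ?thesis by linarith
    qed
    show "real_of_int \<lfloor>(real n)\<^sup>2 / 4\<rfloor> - 8 * real n powr (4/3) \<le> real_of_int (max_cp_cc_gap n) \<and>
       real_of_int (max_cp_cc_gap n) \<le> real_of_int \<lfloor>(real n)\<^sup>2 / 4\<rfloor> - 1/1000 * real n powr (4/3)"
      using lower upper by (simp add: X4)
  qed
qed simp_all

end
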